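(* Let $\mathrm H_n$ be the Heisenberg Lie group with its canonical left-invariant metric. The linear map from the Killing vector fields on $\mathrm H_n$ to $C^\infty(T\mathrm H_n)$ given by $$X^*\longmapsto f_{X^*},\qquad f_{X^*}(v)=\langle X^*,v\rangle\quad(v\in T\mathrm H_n,\ X^*\text{ evaluated at the base point of }v),$$ is a Lie algebra isomorphism between the isometry Lie algebra of $\mathrm H_n$ and the image of the map equipped with the Poisson bracket.
   Context: The Heisenberg group $\mathrm H_n$ is $\mathbb R^{2n}\times\mathbb R$ with product $(v,z)(v',z')=(v+v',\,z+z'-\tfrac12 v^{\tau}Jv')$, where $J$ is multiplication by $i$ on $\mathbb R^{2n}\simeq\mathbb C^n$ ($Je_{2k-1}=e_{2k}$, $Je_{2k}=-e_{2k-1}$). Its Lie algebra $\mathfrak h_n$ has basis $X_1,\dots,X_{2n},Z_1$ with nonzero brackets $[X_{2i-1},X_{2i}]=Z_1$, $i=1,\dots,n$; the canonical metric is the left-invariant Riemannian metric $\langle\cdot,\cdot\rangle$ for which this basis is orthonormal. The isometry group is $\mathrm{Iso}(\mathrm H_n)=K\ltimes\mathrm H_n$, where $\mathrm H_n$ acts by left translations and $K$ is the group of isometric automorphisms of $\mathrm H_n$; its Lie algebra is $\mathfrak{iso}(\mathrm H_n)=\mathfrak k\oplus\mathfrak h_n$, with $\mathfrak k$ the Lie algebra of skew-symmetric derivations of $\mathfrak h_n$. An element $X\in\mathfrak{iso}(\mathrm H_n)$ determines the Killing vector field $X^*(p)=\frac{d}{ds}\big|_{s=0}\exp(sX)\cdot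 p$, and Killing vector fields are identified in this way with $\mathfrak{iso}(\mathrm H_n)$, equipped with its bracket as the Lie algebra of the Lie group $\mathrm{Iso}(\mathrm H_n)$. $T\mathrm H_n$ is identified with $\mathrm H_n\times\mathfrak h_n$, where $(p,Y)$ stands for $dL_p(Y)$, and $T_{(p,Y)}(T\mathrm H_n)$ with $\mathfrak h_n\times\mathfrak h_n$, where $(U,V)$ is the initial velocity of $t\mapsto(p\exp(tU),Y+tV)$. The canonical symplectic form is $\Omega_{(p,Y)}((U,V),(U',V'))=\langle U,V'\rangle-\langle V,U'\rangle+\langle Y,[U,U']\rangle$; the Hamiltonian vector field $X_f$ is defined by $df=\Omega(X_f,\cdot)$, and the Poisson bracket is $\{f,g\}=\Omega(X_f,X_g)$. *)

theory Defs
  imports "HOL-Analysis.Analysis" "HOL-Library.Function_Algebras"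
begin

text \<open>
  Vector fields and functions are plain HOL functions; their vector space operations are the
  pointwise ones. Addition comes from \<^theory>\<open>HOL-Library.Function_Algebras\<close>.
\<close>

instantiation "fun" :: (type, real_vector) real_vector
begin

definition scaleR_fun :: "real \<Rightarrow> ('a \<Rightarrow> 'b) \<Rightarrow> 'a \<Rightarrow> 'b"
  where "scaleR_fun c f = (\<lambda>x. c *\<^sub>R f x)"

instance
  by standard (auto simp: scaleR_fun_def fun_eq_iff algebra_simps)

end


section \<open>Lie algebras, Lie brackets, smooth functions\<close>

definition lie_algebra_on :: "'a::real_vector set \<Rightarrow> ('a \<Rightarrow> 'a \<Rightarrow> 'a) \<Rightarrow> bool" where
  "lie_algebra_on L br \<longleftrightarrow>
     subspace L \<and>
     (\<forall>x\<in>L. \<forall>y\<in>L. br x y \<in> L) \<and>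
     (\<forall>x\<in>L. \<forall>y\<in>L. \<forall>z\<in>L. br (x + y) z = br x z + br y z \<and> br x (y + z) = br x y + br x z) \<and>
     (\<forall>x\<in>L. \<forall>y\<in>L. \<forall>c. br (c *\<^sub>R x) y = c *\<^sub>R br x y \<and> br x (c *\<^sub>R y) = c *\<^sub>R br x y) \<and>
     (\<forall>x\<in>L. br x x = 0) \<and>
     (\<forall>x\<in>L. \<forall>y\<in>L. \<forall>z\<in>L. br x (br y z) + br y (br z x) + br z (br x y) = 0)"

definition lie_algebra_iso ::
    "'a::real_vector set \<Rightarrow> ('a \<Rightarrow> 'a \<Rightarrow> 'a) \<Rightarrow> 'b::real_vector set \<Rightarrow> ('b \<Rightarrow> 'b \<Rightarrow> 'b) \<Rightarrow> ('a \<Rightarrow> 'b) \<Rightarrow> bool"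
  where
  "lie_algebra_iso L br L' br' \<Phi> \<longleftrightarrow>
     lie_algebra_on L br \<and> lie_algebra_on L' br' \<and>
     (\<forall>x\<in>L. \<forall>y\<in>L. \<Phi> (x + y) = \<Phi> x + \<Phi> y) \<and> (\<forall>x\<in>L. \<forall>c. \<Phi> (c *\<^sub>R x) = c *\<^sub>R \<Phi> x) \<and>
     bij_betw \<Phi> L L' \<and>
     (\<forall>x\<in>L. \<forall>y\<in>L. \<Phi> (br x y) = br' (\<Phi> x) (\<Phi> y))"

text \<open>
  Both groups below are given by a multiplication \<open>m\<close> that is defined, and smooth, on a whole
  normed space containing the group as a submanifold. Left-invariant fields then extend to the
  ambient space by the same formula. The bracket of two fields tangent to a submanifold may be
  computed in the ambient space, so \<open>lie_group_bracket m e\<close>, restricted to the tangent space at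
  the unit \<open>e\<close>, is the bracket of the Lie algebra of the group.
\<close>

definition vector_field_bracket :: "('a::real_normed_vector \<Rightarrow> 'a) \<Rightarrow> ('a \<Rightarrow> 'a) \<Rightarrow> 'a \<Rightarrow> 'a" where
  "vector_field_bracket \<xi> \<eta> x =
     frechet_derivative \<eta> (at x) (\<xi> x) - frechet_derivative \<xi> (at x) (\<eta> x)"

definition left_invariant_field ::
    "('a \<Rightarrow> 'a \<Rightarrow> 'a) \<Rightarrow> 'a \<Rightarrow> 'a \<Rightarrow> 'a::real_normed_vector \<Rightarrow> 'a" where
  "left_invariant_field m e X g = frechet_derivative (m g) (at e) X"

definition lie_group_bracket ::
    "('a \<Rightarrow> 'a \<Rightarrow> 'a) \<Rightarrow> 'a \<Rightarrow> 'a \<Rightarrow> 'a \<Rightarrow> 'a::real_normed_vector" where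
  "lie_group_bracket m e X Y =
     vector_field_bracket (left_invariant_field m e X) (left_invariant_field m e Y) e"

primrec Ck :: "nat \<Rightarrow> ('a::euclidean_space \<Rightarrow> 'b::real_normed_vector) \<Rightarrow> bool" where
  "Ck 0 f \<longleftrightarrow> continuous_on UNIV f"
| "Ck (Suc k) f \<longleftrightarrow>
     (\<forall>x. f differentiable (at x)) \<and> (\<forall>v. Ck k (\<lambda>x. frechet_derivative f (at x) v))"

definition smooth :: "('a::euclidean_space \<Rightarrow> 'b::real_normed_vector) \<Rightarrow> bool" where
  "smooth f \<longleftrightarrow> (\<forall>k. Ck k f)"


section \<open>The Heisenberg group\<close>

text \<open>
  \<^typ>\<open>complex^'n\<close> is the real inner product space of dimension \<open>2n\<close>, \<open>n = CARD('n) \<ge> 1\<close>, with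
  orthonormal basis \<open>e\<^bsub>2k-1\<^esub> = axis k 1\<close>, \<open>e\<^bsub>2k\<^esub> = axis k \<i>\<close>. The type \<open>'n heis\<close> serves as the
  group and as its Lie algebra (the tangent space at the unit \<open>0\<close>). The lines \<open>t \<mapsto> t U\<close> are the
  one-parameter subgroups, so in these coordinates the exponential map is the identity.
\<close>

type_synonym 'n heis = "(complex^'n) \<times> real"

definition J :: "complex^'n \<Rightarrow> complex^'n" where
  "J v = (\<chi> k. \<i> * v $ k)"

definition heis_mult :: "'n::finite heis \<Rightarrow> 'n heis \<Rightarrow> 'n heis" where
  "heis_mult p q = (fst p + fst q, snd p + snd q - (1/2) * (fst p \<bullet> J (fst q)))"

lemma heis_mult_line:
  "heis_mult (s *\<^sub>R U) (t *\<^sub>R U) = (s + t) *\<^sub>R (U :: 'n::finite heis)"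
proof -
  have "x \<bullet> J x = 0" and "J (c *\<^sub>R x) = c *\<^sub>R J x" for x :: "complex^'n" and c
    by (simp_all add: J_def inner_vec_def inner_complex_def vec_eq_iff)
  then show ?thesis
    by (simp add: heis_mult_def prod_eq_iff algebra_simps)
qed

definition heis_bracket :: "'n::finite heis \<Rightarrow> 'n heis \<Rightarrow> 'n heis" where
  "heis_bracket = lie_group_bracket heis_mult 0"

text \<open>The differential at the unit of the left translation by \<open>p\<close>.\<close>

definition dL :: "'n::finite heis \<Rightarrow> 'n heis \<Rightarrow> 'n heis" where
  "dL p U = left_invariant_field heis_mult 0 U p"

text \<open>
  The left-invariant metric whose value at the unit is the standard inner product of \<open>'n heis\<close>,
  i.e. the one for which \<open>(axis k 1, 0)\<close>, \<open>(axis k \<i>, 0)\<close>, \<open>(0, 1)\<close> are orthonormal.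
\<close>

definition heis_metric :: "'n::finite heis \<Rightarrow> 'n heis \<Rightarrow> 'n heis \<Rightarrow> real" where
  "heis_metric p w w' = inv (dL p) w \<bullet> inv (dL p) w'"

lemma J_linear: "J (x + y) = J x + J y" "J (c *\<^sub>R x) = c *\<^sub>R J x"
  by (simp_all add: J_def vec_eq_iff algebra_simps)

lemma bounded_linear_J: "bounded_linear (J :: complex^'n \<Rightarrow> complex^'n)"
  by (intro linear_conv_bounded_linear[THEN iffD1] linearI J_linear)

lemma dL_eq: "dL p U = (fst U, snd U - (1/2) * (fst p \<bullet> J (fst U)))"
proof -
  have "(heis_mult p has_derivative
          (\<lambda>U. (fst U, snd U - (1/2) * (fst p \<bullet> J (fst U))))) (at 0)"
    unfolding heis_mult_def [abs_def]
    by (auto intro!: derivative_eq_intros bounded_linear.has_derivative [OF bounded_linear_J]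
        simp: fun_eq_iff)
  from frechet_derivative_at [OF this, symmetric] show ?thesis
    by (simp add: dL_def left_invariant_field_def)
qed

lemma heis_bracket_eq: "heis_bracket X Y = (0, - (fst X \<bullet> J (fst Y)))"
proof -
  have field: "left_invariant_field heis_mult 0 U = (\<lambda>p. (fst U, snd U - (1/2) * (fst p \<bullet> J (fst U))))"
    for U :: "'a heis"
    using dL_eq [of _ U] by (simp add: dL_def fun_eq_iff)
  have "((\<lambda>p. (fst U, snd U - (1/2) * (fst p \<bullet> J (fst U)))) has_derivative
          (\<lambda>V. (0, - (1/2) * (fst V \<bullet> J (fst U))))) (at 0)" for U :: "'a heis"
    by (auto intro!: derivative_eq_intros simp: fun_eq_iff)
  note der = frechet_derivative_at [OF this, symmetric]
  have skew: "y \<bullet> J x = - (x \<bullet> J y)" for x y :: "complex^'a"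
    unfolding sum_negf [symmetric] inner_vec_def
    by (intro sum.cong) (auto simp: J_def inner_complex_def)
  show ?thesis
    unfolding heis_bracket_def lie_group_bracket_def vector_field_bracket_def field der
    using skew [of "fst Y" "fst X"] by simp
qed

lemma heis_bracket_basis:
  "heis_bracket (axis k 1, 0) (axis l \<i>, 0) = (0, if k = l then 1 else 0)"
  "heis_bracket (axis k 1, 0) (axis l 1, 0) = 0"
  "heis_bracket (axis k \<i>, 0) (axis l \<i>, 0) = 0"
  "heis_bracket (0, 1) X = 0"
  for k l :: "'a::finite"
proof -
  have J_axis: "J (axis l c) = axis l (\<i> * c)" for l :: 'a and c
    by (simp add: J_def axis_def vec_eq_iff)
  show "heis_bracket (axis k 1, 0) (axis l \<i>, 0) = (0, if k = l then 1 else 0)"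
    "heis_bracket (axis k 1, 0) (axis l 1, 0) = 0"
    "heis_bracket (axis k \<i>, 0) (axis l \<i>, 0) = 0"
    "heis_bracket (0, 1) X = 0"
    by (simp_all add: heis_bracket_eq J_axis inner_axis_axis inner_complex_def zero_prod_def)
qed


section \<open>The isometry group, its Lie algebra, and Killing vector fields\<close>

text \<open>
  A smooth automorphism of the Heisenberg group is linear in exponential coordinates, hence a
  bounded linear map that is its own differential at every point. \<open>iso_mult\<close> is the product of the
  semidirect product of \<open>K_group\<close> with the Heisenberg group: \<open>(A, p)\<close> is the transformation
  \<open>q \<mapsto> p \<cdot> A q\<close>. The product makes sense for all pairs in the ambient normed space \<open>'n affine_maps\<close>.
\<close>

type_synonym 'n affine_maps = "('n heis \<Rightarrow>\<^sub>L 'n heis) \<times> 'n heis"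

definition K_group :: "('n::finite heis \<Rightarrow>\<^sub>L 'n heis) set" where
  "K_group = {A :: 'n heis \<Rightarrow>\<^sub>L 'n heis. bij (blinfun_apply A) \<and>
     (\<forall>p q. A (heis_mult p q) = heis_mult (A p) (A q)) \<and>
     (\<forall>p w w'. heis_metric (A p) (A w) (A w') = heis_metric p w w')}"

definition Iso_group :: "'n::finite affine_maps set" where
  "Iso_group = K_group \<times> UNIV"

definition iso_mult :: "'n::finite affine_maps \<Rightarrow> 'n affine_maps \<Rightarrow> 'n affine_maps" where
  "iso_mult g h = (fst g o\<^sub>L fst h, heis_mult (snd g) (fst g (snd h)))"

definition iso_one :: "'n::finite affine_maps" where
  "iso_one = (id_blinfun, 0)"

definition iso_act :: "'n::finite affine_maps \<Rightarrow> 'n heis \<Rightarrow> 'n heis" where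
  "iso_act g q = heis_mult (snd g) (fst g q)"

definition k_algebra :: "('n::finite heis \<Rightarrow>\<^sub>L 'n heis) set" where
  "k_algebra = {D :: 'n heis \<Rightarrow>\<^sub>L 'n heis.
     (\<forall>X Y. D (heis_bracket X Y) = heis_bracket (D X) Y + heis_bracket X (D Y)) \<and>
     (\<forall>X Y. D X \<bullet> Y = - (X \<bullet> D Y))}"

definition iso_algebra :: "'n::finite affine_maps set" where
  "iso_algebra = k_algebra \<times> UNIV"

definition iso_bracket :: "'n::finite affine_maps \<Rightarrow> 'n affine_maps \<Rightarrow> 'n affine_maps" where
  "iso_bracket = lie_group_bracket iso_mult iso_one"

definition one_param_subgroup :: "'n::finite affine_maps \<Rightarrow> (real \<Rightarrow> 'n affine_maps) \<Rightarrow> bool" where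
  "one_param_subgroup X \<gamma> \<longleftrightarrow>
     (\<forall>s. \<gamma> s \<in> Iso_group) \<and> \<gamma> 0 = iso_one \<and> (\<forall>s t. \<gamma> (s + t) = iso_mult (\<gamma> s) (\<gamma> t)) \<and>
     (\<gamma> has_vector_derivative X) (at 0)"

definition iso_exp :: "'n::finite affine_maps \<Rightarrow> 'n affine_maps" where
  "iso_exp X = (THE \<gamma>. one_param_subgroup X \<gamma>) 1"

definition killing_field :: "'n::finite affine_maps \<Rightarrow> 'n heis \<Rightarrow> 'n heis" where
  "killing_field X p = vector_derivative (\<lambda>s. iso_act (iso_exp (s *\<^sub>R X)) p) (at 0)"

definition killing_fields :: "('n::finite heis \<Rightarrow> 'n heis) set" where
  "killing_fields = killing_field ` iso_algebra"

text \<open>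
  The bracket transported from the isometry algebra along \<open>X \<mapsto> killing_field X\<close>; it is the negative
  of the bracket of vector fields.
\<close>

definition killing_bracket ::
    "('n::finite heis \<Rightarrow> 'n heis) \<Rightarrow> ('n heis \<Rightarrow> 'n heis) \<Rightarrow> 'n heis \<Rightarrow> 'n heis" where
  "killing_bracket \<xi> \<eta> =
     killing_field (iso_bracket (inv_into iso_algebra killing_field \<xi>)
                                (inv_into iso_algebra killing_field \<eta>))"


section \<open>The symplectic structure of the tangent bundle\<close>

text \<open>
  The pair \<open>(p, Y)\<close> stands for the tangent vector \<open>dL p Y\<close> at \<open>p\<close>, and \<open>(U, V)\<close> for the initial
  velocity of \<open>t \<mapsto> (p \<cdot> exp (t U), Y + t V)\<close>, where \<open>exp (t U) = t U\<close>.
\<close>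

type_synonym 'n heis_TM = "'n heis \<times> 'n heis"

definition TM_velocity :: "'n::finite heis_TM \<Rightarrow> 'n heis_TM \<Rightarrow> 'n heis_TM" where
  "TM_velocity x W =
     vector_derivative (\<lambda>t. (heis_mult (fst x) (t *\<^sub>R fst W), snd x + t *\<^sub>R snd W)) (at 0)"

definition differential :: "('n::finite heis_TM \<Rightarrow> real) \<Rightarrow> 'n heis_TM \<Rightarrow> 'n heis_TM \<Rightarrow> real" where
  "differential f x W = frechet_derivative f (at x) (TM_velocity x W)"

definition \<Omega> :: "'n::finite heis_TM \<Rightarrow> 'n heis_TM \<Rightarrow> 'n heis_TM \<Rightarrow> real" where
  "\<Omega> x W W' = fst W \<bullet> snd W' - snd W \<bullet> fst W' + snd x \<bullet> heis_bracket (fst W) (fst W')"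

definition hamiltonian_field :: "('n::finite heis_TM \<Rightarrow> real) \<Rightarrow> 'n heis_TM \<Rightarrow> 'n heis_TM" where
  "hamiltonian_field f x = (THE W. \<forall>W'. differential f x W' = \<Omega> x W W')"

definition poisson_bracket ::
    "('n::finite heis_TM \<Rightarrow> real) \<Rightarrow> ('n heis_TM \<Rightarrow> real) \<Rightarrow> 'n heis_TM \<Rightarrow> real" where
  "poisson_bracket f g x = \<Omega> x (hamiltonian_field f x) (hamiltonian_field g x)"

definition linear_function :: "('n::finite heis \<Rightarrow> 'n heis) \<Rightarrow> 'n heis_TM \<Rightarrow> real" where
  "linear_function \<xi> x = heis_metric (fst x) (\<xi> (fst x)) (dL (fst x) (snd x))"

end

(* Since p q = p + q + 1/2 [p, q], everything is computed with the 2-step nilpotent bracket.  For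
   X = (D, U) with D a skew derivation, the one-parameter group of X is s |-> (exp (s D), p(s)) with
   p' = dL_p (exp (s D) U), so the Killing field of X is D p + U + 1/2 [U, p].  Translated back to
   the unit it is F(p) = D p + U + [U, p] - 1/2 [p, D p].  Its differential along dL_p W is
   D W + [F(p), W], so f(p, Y) = F(p) . Y has the Hamiltonian field (F(p), D Y), and
   {f, f'} = (D F' - D' F + [F, F']) . Y, which is the function of the bracket
   ([D, D'], D U' - D' U + [U, U']) of the semidirect product. *)

theory Submission
  imports Defs
begin

section \<open>The exponential of a bounded operator\<close>

text \<open>
  \<^typ>\<open>'a \<Rightarrow>\<^sub>L 'a\<close> is an instance of no algebra class; the copy below is a Banach algebra, so that
  \<^const>\<open>exp\<close> and its theory become available for operators.
\<close>

typedef (overloaded) 'a operator = "UNIV :: ('a::euclidean_space \<Rightarrow>\<^sub>L 'a) set"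
  morphisms blinfun_of Operator ..

setup_lifting type_definition_operator

instantiation operator :: (euclidean_space) real_normed_algebra_1
begin

lift_definition zero_operator :: "'a operator" is 0 .
lift_definition one_operator :: "'a operator" is id_blinfun .
lift_definition plus_operator :: "'a operator \<Rightarrow> 'a operator \<Rightarrow> 'a operator" is "(+)" .
lift_definition minus_operator :: "'a operator \<Rightarrow> 'a operator \<Rightarrow> 'a operator" is "(-)" .
lift_definition uminus_operator :: "'a operator \<Rightarrow> 'a operator" is uminus .
lift_definition times_operator :: "'a operator \<Rightarrow> 'a operator \<Rightarrow> 'a operator" is "(o\<^sub>L)" .
lift_definition scaleR_operator :: "real \<Rightarrow> 'a operator \<Rightarrow> 'a operator" is scaleR .
lift_definition norm_operator :: "'a operator \<Rightarrow> real" is norm .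
lift_definition dist_operator :: "'a operator \<Rightarrow> 'a operator \<Rightarrow> real" is dist .
lift_definition sgn_operator :: "'a operator \<Rightarrow> 'a operator" is sgn .
definition "(uniformity :: ('a operator \<times> 'a operator) filter) =
  (INF e\<in>{0 <..}. principal {(x, y). dist x y < e})"
definition "open U = (\<forall>x\<in>U. \<forall>\<^sub>F (x', y) in uniformity. x' = x \<longrightarrow> y \<in> U)"
  for U :: "'a operator set"

instance
proof
  \<comment> \<open>A Euclidean space is never the zero space, so the identity has norm 1.\<close>
  have "(id_blinfun :: 'a \<Rightarrow>\<^sub>L 'a) \<noteq> 0"
    using norm_blinfun_id [where 'a = 'a] by (metis norm_zero zero_neq_one)
  then show "(0 :: 'a operator) \<noteq> 1"
    by transfer simp
qed (unfold uniformity_operator_def open_operator_def,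
     (transfer; auto simp: algebra_simps norm_triangle_ineq norm_blinfun_compose dist_norm sgn_div_norm
        blinfun.bilinear_simps intro!: blinfun_eqI)+)

end

lemma bounded_linear_blinfun_of: "bounded_linear blinfun_of"
  by (rule bounded_linear_intro [of _ 1]) (transfer; simp)+

text \<open>Completeness carries over because the copy has the same distance as the space of bounded
  linear maps, which is complete.\<close>

instance operator :: (euclidean_space) banach
proof
  fix X :: "nat \<Rightarrow> 'a operator"
  assume "Cauchy X"
  then have "Cauchy (\<lambda>n. blinfun_of (X n))"
    unfolding Cauchy_def by transfer
  then obtain L where "(\<lambda>n. blinfun_of (X n)) \<longlonglongrightarrow> L"
    using Cauchy_convergent convergent_def by blast
  then have "X \<longlonglongrightarrow> Operator L"
    unfolding LIMSEQ_def by (simp add: dist_operator.rep_eq Operator_inverse)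
  then show "convergent X"
    unfolding convergent_def by blast
qed

definition blinfun_exp :: "('a::euclidean_space \<Rightarrow>\<^sub>L 'a) \<Rightarrow> 'a \<Rightarrow>\<^sub>L 'a" where
  "blinfun_exp D = blinfun_of (exp (Operator D))"

lemma Operator_scaleR: "Operator (t *\<^sub>R D) = t *\<^sub>R Operator D"
  by (simp add: scaleR_operator.abs_eq eq_onp_same_args)

lemma blinfun_exp_0 [simp]: "blinfun_exp 0 = id_blinfun"
  by (simp add: blinfun_exp_def zero_operator.abs_eq [symmetric] one_operator.rep_eq)

text \<open>Multiples of one operator commute, and on commuting elements of a Banach algebra
  \<open>exp\<close> turns sums into products.\<close>

lemma blinfun_exp_add: "blinfun_exp ((s + t) *\<^sub>R D) = blinfun_exp (s *\<^sub>R D) o\<^sub>L blinfun_exp (t *\<^sub>R D)"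
proof -
  have "exp ((s + t) *\<^sub>R Operator D) = exp (s *\<^sub>R Operator D) * exp (t *\<^sub>R Operator D)"
    unfolding scaleR_add_left by (rule exp_add_commuting) simp
  then show ?thesis
    by (simp add: blinfun_exp_def Operator_scaleR times_operator.rep_eq)
qed

lemma blinfun_exp_inverse:
  "blinfun_exp (t *\<^sub>R D) o\<^sub>L blinfun_exp (- t *\<^sub>R D) = id_blinfun"
  "blinfun_exp (- t *\<^sub>R D) o\<^sub>L blinfun_exp (t *\<^sub>R D) = id_blinfun"
  unfolding blinfun_exp_add [symmetric] by simp_all

lemma blinfun_exp_has_vector_derivative:
  "((\<lambda>t. blinfun_exp (t *\<^sub>R D)) has_vector_derivative D o\<^sub>L blinfun_exp (t *\<^sub>R D)) (at t)"
  using bounded_linear.has_vector_derivative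
    [OF bounded_linear_blinfun_of exp_scaleR_has_vector_derivative_left [of "Operator D" t]]
  by (simp add: blinfun_exp_def Operator_scaleR times_operator.rep_eq Operator_inverse)

section \<open>The Heisenberg group in terms of its bracket\<close>

lemma inner_J_skew: "x \<bullet> J y = - (y \<bullet> J x)" for x y :: "complex^'n::finite"
  unfolding sum_negf [symmetric] inner_vec_def
  by (intro sum.cong) (auto simp: J_def inner_complex_def)

lemma bounded_bilinear_heis_bracket:
  "bounded_bilinear (heis_bracket :: 'n::finite heis \<Rightarrow> 'n heis \<Rightarrow> 'n heis)"
proof -
  have "bilinear (heis_bracket :: 'n heis \<Rightarrow> 'n heis \<Rightarrow> 'n heis)"
    unfolding bilinear_def
    by (auto intro!: linearI simp: heis_bracket_eq J_linear inner_add_left inner_add_right)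
  then show ?thesis
    by (simp add: bilinear_conv_bounded_bilinear)
qed

interpretation heis_bracket: bounded_bilinear heis_bracket
  by (rule bounded_bilinear_heis_bracket)

lemma heis_bracket_skew: "heis_bracket y x = - heis_bracket x y"
  using inner_J_skew [of "fst x" "fst y"] by (simp add: heis_bracket_eq)

lemma heis_bracket_self [simp]: "heis_bracket x x = 0"
  using inner_J_skew [of "fst x" "fst x"] by (simp add: heis_bracket_eq zero_prod_def)

text \<open>Brackets lie in the centre, spanned by \<open>(0, 1)\<close>. As a simplification rule
  this cuts off every later expansion after one bracket.\<close>

lemma heis_bracket_bracket [simp]:
  "heis_bracket (heis_bracket x y) z = 0" "heis_bracket z (heis_bracket x y) = 0"
  by (simp_all add: heis_bracket_eq zero_prod_def J_def inner_vec_def)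

text \<open>The Baker-Campbell-Hausdorff formula in exponential coordinates; the series ends here by
  nilpotency.\<close>

lemma heis_mult_bracket: "heis_mult p q = p + q + (1/2) *\<^sub>R heis_bracket p q"
  by (simp add: heis_mult_def heis_bracket_eq prod_eq_iff)

lemma dL_bracket: "dL p U = U + (1/2) *\<^sub>R heis_bracket p U"
  by (simp add: dL_eq heis_bracket_eq prod_eq_iff)

lemmas bracket_simps = heis_bracket.add_left heis_bracket.add_right heis_bracket.diff_left
  heis_bracket.diff_right heis_bracket.scaleR_left heis_bracket.scaleR_right
  heis_bracket.minus_left heis_bracket.minus_right

text \<open>Instances are handed to the simplifier wherever two halves of the same bracket have to
  be merged.\<close>

lemma half_add_half: "(1/2) *\<^sub>R z + (1/2) *\<^sub>R z = z" for z :: "'a::real_vector"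
  by (simp flip: scaleR_add_left)

text \<open>The operator \<open>N = heis_bracket p\<close> satisfies \<open>N N = 0\<close>, so
  \<open>1 + N/2\<close> has the inverse \<open>1 - N/2\<close>.\<close>

lemma dL_inverse: "dL p (w - (1/2) *\<^sub>R heis_bracket p w) = w"
  "dL p w - (1/2) *\<^sub>R heis_bracket p (dL p w) = w"
  by (simp_all add: dL_bracket bracket_simps)

lemma bij_dL: "bij (dL p)"
  by (rule o_bij [of "\<lambda>w. w - (1/2) *\<^sub>R heis_bracket p w"]) (simp_all add: fun_eq_iff dL_inverse)

lemma inv_dL: "inv (dL p) w = w - (1/2) *\<^sub>R heis_bracket p w"
  by (metis bij_dL bij_inv_eq_iff dL_inverse(1))

lemma heis_mult_line_has_vector_derivative:
  "((\<lambda>t. heis_mult p (t *\<^sub>R U)) has_vector_derivative dL p U) (at 0)"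
  unfolding heis_mult_bracket dL_bracket bracket_simps
  by (auto intro!: derivative_eq_intros)


section \<open>One-parameter groups of isometries\<close>

lemma k_algebra_bracket:
  "D \<in> k_algebra \<Longrightarrow> D (heis_bracket x y) = heis_bracket (D x) y + heis_bracket x (D y)"
  unfolding k_algebra_def by blast

lemma k_algebra_skew: "D \<in> k_algebra \<Longrightarrow> D x \<bullet> y = - (x \<bullet> D y)"
  unfolding k_algebra_def by blast

section \<open>Calculus of curves in normed spaces\<close>

lemma has_vector_derivative_zero_unique:
  fixes f :: "real \<Rightarrow> 'a::real_normed_vector"
  assumes "\<And>t. (f has_vector_derivative 0) (at t)"
  shows "f s = f t"
  using has_derivative_zero_unique [of UNIV f s t] assms by (simp add: has_vector_derivative_def)

lemma has_vector_derivative_unique: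
  fixes f g :: "real \<Rightarrow> 'a::real_normed_vector"
  assumes "\<And>t. (f has_vector_derivative h t) (at t)" "\<And>t. (g has_vector_derivative h t) (at t)"
    and "f 0 = g 0"
  shows "f t = g t"
proof -
  have "((\<lambda>t. f t - g t) has_vector_derivative 0) (at t)" for t
    using has_vector_derivative_diff [OF assms(1) [of t] assms(2) [of t]] by simp
  from has_vector_derivative_zero_unique [OF this, of t 0] assms(3) show ?thesis
    by simp
qed

text \<open>Serves to shift time (\<open>c = 1\<close>) and to rescale it
  (\<open>a = 0\<close>).\<close>

lemma has_vector_derivative_compose_affine:
  assumes "(f has_vector_derivative f') (at (a + c * t))"
  shows "((\<lambda>t. f (a + c * t)) has_vector_derivative c *\<^sub>R f') (at t)"
proof -
  have "((\<lambda>t. a + c * t) has_vector_derivative c) (at t)"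
    unfolding has_real_derivative_iff_has_vector_derivative [symmetric]
    by (auto intro!: derivative_eq_intros)
  from vector_diff_chain_at [OF this assms] show ?thesis
    by (simp add: o_def)
qed

lemma antiderivative_exists:
  fixes f :: "real \<Rightarrow> 'a::euclidean_space"
  assumes "\<And>t. isCont f t"
  obtains F where "\<And>t. (F has_vector_derivative f t) (at t)" "F 0 = 0"
proof -
  obtain F where F: "\<And>t. (F has_vector_derivative f t) (at t)"
    \<comment> \<open>Infinite endpoints make the interval the whole line, so negative times are
      covered too.\<close>
    using einterval_antiderivative [of "-\<infinity>" "\<infinity>" f] assms by auto
  have "((\<lambda>t. F t - F 0) has_vector_derivative f t) (at t)" for t
    using F [of t] by (auto intro!: derivative_eq_intros)
  with that [of "\<lambda>t. F t - F 0"] show thesis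
    by simp
qed

lemma has_vector_derivative_blinfun_apply:
  assumes "(A has_vector_derivative A') (at t within S)"
    and "(x has_vector_derivative x') (at t within S)"
  shows "((\<lambda>t. blinfun_apply (A t) (x t)) has_vector_derivative A t x' + A' (x t)) (at t within S)"
  by (rule bounded_bilinear.has_vector_derivative [OF bounded_bilinear_blinfun_apply assms])

section \<open>The flow of a skew derivation consists of isometric automorphisms\<close>

lemma blinfun_exp_apply_has_vector_derivative:
  "((\<lambda>t. blinfun_exp (t *\<^sub>R D) x) has_vector_derivative D (blinfun_exp (t *\<^sub>R D) x)) (at t)"
  using has_vector_derivative_blinfun_apply
    [OF blinfun_exp_has_vector_derivative [of D t] has_vector_derivative_const [of x]]
  by (simp add: blinfun.zero_right)

text \<open>With \<open>u\<close>, \<open>v\<close> the moved vectors, the derivative in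
  \<open>t\<close> is \<open>u \<bullet> D v + D u \<bullet> v\<close>, which vanishes by
  skewness.\<close>

lemma blinfun_exp_inner:
  assumes "D \<in> k_algebra"
  shows "blinfun_exp (t *\<^sub>R D) x \<bullet> blinfun_exp (t *\<^sub>R D) y = x \<bullet> y"
proof -
  let ?f = "\<lambda>t. blinfun_exp (t *\<^sub>R D) x \<bullet> blinfun_exp (t *\<^sub>R D) y"
  have "(?f has_vector_derivative 0) (at t)" for t
    using bounded_bilinear.has_vector_derivative [OF bounded_bilinear_inner
        blinfun_exp_apply_has_vector_derivative [of D x t]
        blinfun_exp_apply_has_vector_derivative [of D y t]]
    by (simp add: k_algebra_skew [OF assms])
  from has_vector_derivative_zero_unique [of ?f, OF this, of t 0] show ?thesis
    by simp
qed

lemma blinfun_exp_inverse_apply: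
  "blinfun_exp (t *\<^sub>R D) (blinfun_exp (- t *\<^sub>R D) x) = x"
  "blinfun_exp (- t *\<^sub>R D) (blinfun_exp (t *\<^sub>R D) x) = x"
  using blinfun_exp_inverse [of t D] by (metis blinfun_apply_blinfun_compose blinfun_apply_id_blinfun id_apply)+

text \<open>Two solutions stay at constant distance, since their difference is moved orthogonally to itself.\<close>

lemma skew_ode_unique:
  assumes D: "D \<in> k_algebra" and y: "\<And>t. (y has_vector_derivative D (y t)) (at t)"
  shows "y t = blinfun_exp (t *\<^sub>R D) (y 0)"
proof -
  let ?w = "\<lambda>t. y t - blinfun_exp (t *\<^sub>R D) (y 0)"
  have "((\<lambda>t. ?w t \<bullet> ?w t) has_vector_derivative 0) (at t)" for t
  proof -
    have w: "(?w has_vector_derivative D (?w t)) (at t)"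
      using has_vector_derivative_diff [OF y [of t] blinfun_exp_apply_has_vector_derivative [of D "y 0" t]]
      by (simp add: blinfun.diff_right)
    show ?thesis
      using bounded_bilinear.has_vector_derivative [OF bounded_bilinear_inner w w]
      by (simp add: k_algebra_skew [OF D])
  qed
  from has_vector_derivative_zero_unique [OF this, of t 0] show ?thesis
    by simp
qed

text \<open>Because \<open>D\<close> is a derivation, the right-hand side solves
  \<open>y' = D y\<close>, and it starts at \<open>heis_bracket x y\<close>; uniqueness does the
  rest.\<close>

lemma blinfun_exp_bracket:
  assumes "D \<in> k_algebra"
  shows "blinfun_exp (t *\<^sub>R D) (heis_bracket x y) =
    heis_bracket (blinfun_exp (t *\<^sub>R D) x) (blinfun_exp (t *\<^sub>R D) y)"
proof -
  let ?f = "\<lambda>t. heis_bracket (blinfun_exp (t *\<^sub>R D) x) (blinfun_exp (t *\<^sub>R D) y)"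
  have "(?f has_vector_derivative D (?f t)) (at t)" for t
    using heis_bracket.has_vector_derivative [OF
        blinfun_exp_apply_has_vector_derivative [of D x t]
        blinfun_exp_apply_has_vector_derivative [of D y t]]
    by (simp add: k_algebra_bracket [OF assms] add.commute)
  from skew_ode_unique [of D ?f, OF assms this, of t] show ?thesis
    by simp
qed

lemma blinfun_exp_K_group:
  assumes "D \<in> k_algebra"
  shows "blinfun_exp (t *\<^sub>R D) \<in> K_group"
proof -
  let ?A = "blinfun_exp (t *\<^sub>R D)"
  have "bij ?A"
    by (rule o_bij [of "blinfun_exp (- t *\<^sub>R D)"])
      (simp_all add: fun_eq_iff blinfun_exp_inverse_apply del: scaleR_minus_left)
  moreover have "?A (heis_mult p q) = heis_mult (?A p) (?A q)" for p q
    by (simp add: heis_mult_bracket blinfun.bilinear_simps blinfun_exp_bracket [OF assms])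
  moreover have "heis_metric (?A p) (?A w) (?A w') = heis_metric p w w'" for p w w'
  proof -
    \<comment> \<open>An automorphism commutes with the translation back to the unit, so only
      orthogonality at the unit remains.\<close>
    have "inv (dL (?A p)) (?A u) = ?A (inv (dL p) u)" for u
      by (simp add: inv_dL blinfun.bilinear_simps blinfun_exp_bracket [OF assms])
    then show ?thesis
      by (simp add: heis_metric_def blinfun_exp_inner [OF assms])
  qed
  ultimately show ?thesis
    unfolding K_group_def by blast
qed

lemma blinfun_compose_id [simp]: "A o\<^sub>L id_blinfun = A" "id_blinfun o\<^sub>L A = A"
  by (auto intro: blinfun_eqI)

section \<open>Existence and uniqueness of one-parameter subgroups\<close>

lemma one_param_subgroup_exists:
  assumes "X \<in> iso_algebra"
  obtains \<gamma> where "one_param_subgroup X \<gamma>"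
proof -
  obtain D U where X: "X = (D, U)" and D: "D \<in> k_algebra"
    using assms by (auto simp: iso_algebra_def)
  let ?E = "\<lambda>t. blinfun_exp (t *\<^sub>R D)"
  have E: "((\<lambda>t. ?E t U) has_vector_derivative D (?E t U)) (at t)" for t
    by (rule blinfun_exp_apply_has_vector_derivative)
  \<comment> \<open>The translation part \<open>p\<close> has to solve
    \<open>p' = E U + (1/2) [p, E U]\<close>. By nilpotency two successive integrations suffice:
    \<open>q' = E U\<close>, then the correction \<open>r' = (1/2) [q, E U]\<close>.\<close>
  obtain q where q: "\<And>t. (q has_vector_derivative ?E t U) (at t)" "q 0 = 0"
    using antiderivative_exists [of "\<lambda>t. ?E t U"] has_vector_derivative_continuous [OF E] by blast
  have "isCont (\<lambda>t. (1/2) *\<^sub>R heis_bracket (q t) (?E t U)) t" for t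
    by (intro continuous_intros heis_bracket.continuous has_vector_derivative_continuous [OF E]
        has_vector_derivative_continuous [OF q(1)])
  then obtain r where
    r: "\<And>t. (r has_vector_derivative (1/2) *\<^sub>R heis_bracket (q t) (?E t U)) (at t)" "r 0 = 0"
    using antiderivative_exists [of "\<lambda>t. (1/2) *\<^sub>R heis_bracket (q t) (?E t U)"] by blast
  \<comment> \<open>\<open>q + r\<close> solves the equation: bracketing with \<open>r\<close> gives zero, because it does so for \<open>r'\<close>.\<close>
  have r_central: "heis_bracket (r t) w = 0" for t w
    using has_vector_derivative_zero_unique [of "\<lambda>t. heis_bracket (r t) w" t 0]
      bounded_linear.has_vector_derivative [OF heis_bracket.bounded_linear_left [of w] r(1)] r(2)
    by (simp add: bracket_simps heis_bracket.zero_left)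
  have r_central': "heis_bracket w (r t) = 0" for t w
    using heis_bracket_skew [of w "r t"] r_central [of t w] by simp
  have shift: "((\<lambda>t. f (s + t)) has_vector_derivative f' (s + t)) (at t)"
    if "\<And>t. (f has_vector_derivative f' t) (at t)" for f f' :: "real \<Rightarrow> 'a heis" and s t
    using has_vector_derivative_compose_affine [of f "f' (s + t)" s 1 t] that by simp
  \<comment> \<open>As functions of \<open>t\<close> both sides have the derivative
    \<open>?E (s + t) U\<close> and agree at \<open>t = 0\<close>.\<close>
  have q_add: "q (s + t) = q s + ?E s (q t)" for s t
  proof (rule has_vector_derivative_unique [where t = t])
    show "((\<lambda>t. q (s + t)) has_vector_derivative ?E (s + t) U) (at t)" for t
      using shift [OF q(1)] .
    show "((\<lambda>t. q s + ?E s (q t)) has_vector_derivative ?E (s + t) U) (at t)" for t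
      using has_vector_derivative_add [OF has_vector_derivative_const [of "q s"]
          bounded_linear.has_vector_derivative [OF blinfun.bounded_linear_right [of "?E s"] q(1)]]
      by (simp add: blinfun_exp_add)
  qed (simp add: q(2) blinfun.zero_right)
  \<comment> \<open>The last term is the bracket correction in the group product of
    \<open>q s\<close> and \<open>?E s (q t)\<close>; this makes \<open>q + r\<close>
    multiplicative.\<close>
  have r_add: "r (s + t) = r s + ?E s (r t) + (1/2) *\<^sub>R heis_bracket (q s) (?E s (q t))" for s t
  proof (rule has_vector_derivative_unique [where t = t])
    show "((\<lambda>t. r (s + t)) has_vector_derivative
        (1/2) *\<^sub>R heis_bracket (q (s + t)) (?E (s + t) U)) (at t)" for t
      using shift [OF r(1)] .
    show "((\<lambda>t. r s + ?E s (r t) + (1/2) *\<^sub>R heis_bracket (q s) (?E s (q t))) has_vector_derivative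
        (1/2) *\<^sub>R heis_bracket (q (s + t)) (?E (s + t) U)) (at t)" for t
    proof -
      \<comment> \<open>Inserting \<open>q_add\<close> splits the integrand into the derivatives of
        the three summands; the leading \<open>0\<close> belongs to the constant
        \<open>r s\<close>.\<close>
      have "(1/2) *\<^sub>R heis_bracket (q (s + t)) (?E (s + t) U) =
        0 + ?E s ((1/2) *\<^sub>R heis_bracket (q t) (?E t U)) + (1/2) *\<^sub>R heis_bracket (q s) (?E s (?E t U))"
        by (simp add: q_add blinfun_exp_add blinfun_exp_bracket [OF D] bracket_simps
            blinfun.bilinear_simps scaleR_add_right add.commute)
      then show ?thesis
        by (simp only:) (intro has_vector_derivative_add has_vector_derivative_const
            bounded_linear.has_vector_derivative [OF blinfun.bounded_linear_right]
            bounded_linear.has_vector_derivative [OF heis_bracket.bounded_linear_right]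
            bounded_linear.has_vector_derivative [OF bounded_linear_scaleR_right] q r)
    qed
  qed (simp add: q(2) r(2) blinfun.zero_right heis_bracket.zero_right)
  have "one_param_subgroup X (\<lambda>t. (?E t, q t + r t))"
    unfolding one_param_subgroup_def X
  proof (intro conjI allI)
    show "(?E t, q t + r t) \<in> Iso_group" for t
      by (simp add: Iso_group_def blinfun_exp_K_group [OF D])
    show "(?E 0, q 0 + r 0) = iso_one"
      by (simp add: iso_one_def q(2) r(2))
    show "(?E (s + t), q (s + t) + r (s + t)) = iso_mult (?E s, q s + r s) (?E t, q t + r t)" for s t
    proof -
      \<comment> \<open>An automorphism preserves the centre: write \<open>w\<close> as
        \<open>?E s\<close> applied to \<open>?E (- s) w\<close>.\<close>
      have "heis_bracket w (?E s (r t)) = 0" for w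
        using blinfun_exp_bracket [OF D, of s "?E (- s) w" "r t"]
        by (simp only: blinfun_exp_inverse_apply r_central' blinfun.zero_right)
      then show ?thesis
        by (simp add: iso_mult_def blinfun_exp_add heis_mult_bracket q_add r_add bracket_simps
            r_central blinfun.bilinear_simps)
    qed
    show "((\<lambda>t. (?E t, q t + r t)) has_vector_derivative (D, U)) (at 0)"
      using has_vector_derivative_Pair [OF blinfun_exp_has_vector_derivative [of D 0]
          has_vector_derivative_add [OF q(1) [of 0] r(1) [of 0]]]
      by (simp add: q(2) heis_bracket.zero_left)
  qed
  then show thesis ..
qed

text \<open>Differentiating the homomorphism law in one factor at the unit turns it into a
  differential equation.\<close>

lemma one_param_subgroup_ode:
  assumes "one_param_subgroup (D, U) \<gamma>"
  shows "((\<lambda>t. fst (\<gamma> t)) has_vector_derivative D o\<^sub>L fst (\<gamma> t)) (at t)"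
    and "((\<lambda>t. snd (\<gamma> t)) has_vector_derivative dL (snd (\<gamma> t)) (fst (\<gamma> t) U)) (at t)"
proof -
  have shift: "(f has_vector_derivative f') (at t)"
    if "((\<lambda>h. f (t + h)) has_vector_derivative f') (at 0)"
    for f :: "real \<Rightarrow> 'c::real_normed_vector" and f'
    using has_vector_derivative_compose_affine [of "\<lambda>h. f (t + h)" f' "- t" 1 t] that by simp
  have \<gamma>: "\<gamma> 0 = iso_one" "\<gamma> (s + t) = iso_mult (\<gamma> s) (\<gamma> t)"
    "(\<gamma> has_vector_derivative (D, U)) (at 0)" for s t
    using assms by (auto simp: one_param_subgroup_def)
  have A: "((\<lambda>t. fst (\<gamma> t)) has_vector_derivative D) (at 0)"
    and p: "((\<lambda>t. snd (\<gamma> t)) has_vector_derivative U) (at 0)"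
    using bounded_linear.has_vector_derivative [OF bounded_linear_fst \<gamma>(3)]
      bounded_linear.has_vector_derivative [OF bounded_linear_snd \<gamma>(3)] by simp_all
  show "((\<lambda>t. fst (\<gamma> t)) has_vector_derivative D o\<^sub>L fst (\<gamma> t)) (at t)"
    using bounded_linear.has_vector_derivative
      [OF bounded_bilinear.bounded_linear_left [OF bounded_bilinear_blinfun_compose] A, of "fst (\<gamma> t)"]
    \<comment> \<open>Swapping the summands makes the varying factor the left one, so that
      \<open>D\<close> comes out on the left.\<close>
    by (intro shift) (simp add: add.commute [of t] \<gamma>(2) iso_mult_def)
  have Ap: "((\<lambda>h. fst (\<gamma> t) (snd (\<gamma> h))) has_vector_derivative fst (\<gamma> t) U) (at 0)"
    by (rule bounded_linear.has_vector_derivative [OF blinfun.bounded_linear_right p])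
  have "((\<lambda>h. snd (\<gamma> t) + fst (\<gamma> t) (snd (\<gamma> h)) +
        (1/2) *\<^sub>R heis_bracket (snd (\<gamma> t)) (fst (\<gamma> t) (snd (\<gamma> h)))) has_vector_derivative
      0 + fst (\<gamma> t) U + (1/2) *\<^sub>R heis_bracket (snd (\<gamma> t)) (fst (\<gamma> t) U)) (at 0)"
    by (intro has_vector_derivative_add has_vector_derivative_const Ap
        bounded_linear.has_vector_derivative [OF heis_bracket.bounded_linear_right]
        bounded_linear.has_vector_derivative [OF bounded_linear_scaleR_right])
  then show "((\<lambda>t. snd (\<gamma> t)) has_vector_derivative dL (snd (\<gamma> t)) (fst (\<gamma> t) U)) (at t)"
    by (intro shift) (simp add: \<gamma>(2) iso_mult_def heis_mult_bracket dL_bracket)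
qed

text \<open>The linear parts solve the same linear equation. The difference \<open>w\<close> of the
  translation parts satisfies \<open>w' = (1/2) [w, E U]\<close>, which is central; hence
  \<open>[w, y]\<close> is constant, equal to its initial value 0, and
  \<open>w' = 0\<close>.\<close>

lemma one_param_subgroup_unique:
  assumes "X \<in> iso_algebra" and \<gamma>: "one_param_subgroup X \<gamma>" and \<delta>: "one_param_subgroup X \<delta>"
  shows "\<gamma> = \<delta>"
proof
  fix t
  obtain D U where X: "X = (D, U)" and D: "D \<in> k_algebra"
    using assms(1) by (auto simp: iso_algebra_def)
  have unit: "\<gamma> 0 = (id_blinfun, 0)" "\<delta> 0 = (id_blinfun, 0)"
    using \<gamma> \<delta> by (simp_all add: one_param_subgroup_def iso_one_def)
  have exp: "fst (\<eta> t) = blinfun_exp (t *\<^sub>R D)" if "one_param_subgroup X \<eta>" for \<eta> t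
  proof (rule blinfun_eqI)
    fix x
    have "((\<lambda>t. fst (\<eta> t) x) has_vector_derivative D (fst (\<eta> t) x)) (at t)" for t
      using has_vector_derivative_blinfun_apply [OF one_param_subgroup_ode(1) [OF that [unfolded X]]
          has_vector_derivative_const [of x]]
      by (simp add: blinfun.zero_right)
    from skew_ode_unique [OF D this, of t] show "fst (\<eta> t) x = blinfun_exp (t *\<^sub>R D) x"
      using that by (simp add: one_param_subgroup_def iso_one_def)
  qed
  let ?w = "\<lambda>t. snd (\<gamma> t) - snd (\<delta> t)"
  have w: "(?w has_vector_derivative (1/2) *\<^sub>R heis_bracket (?w t) (blinfun_exp (t *\<^sub>R D) U)) (at t)" for t
    using has_vector_derivative_diff [OF one_param_subgroup_ode(2) [OF \<gamma> [unfolded X]]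
        one_param_subgroup_ode(2) [OF \<delta> [unfolded X]]]
    by (simp add: exp \<gamma> \<delta> dL_bracket bracket_simps scaleR_diff_right)
  have "heis_bracket (?w t) y = 0" for t y
    using has_vector_derivative_zero_unique [of "\<lambda>t. heis_bracket (?w t) y" t 0]
      bounded_linear.has_vector_derivative [OF heis_bracket.bounded_linear_left [of y] w]
    by (simp add: bracket_simps heis_bracket.zero_left unit)
  with w have "(?w has_vector_derivative 0) (at t)" for t
    by simp
  from has_vector_derivative_zero_unique [of ?w, OF this, of t 0] have "snd (\<gamma> t) = snd (\<delta> t)"
    by (simp add: unit)
  then show "\<gamma> t = \<delta> t"
    by (simp add: prod_eq_iff exp \<gamma> \<delta>)
qed

section \<open>The exponential map of the isometry group and the Killing fields\<close>

lemma iso_algebra_scaleR: "X \<in> iso_algebra \<Longrightarrow> s *\<^sub>R X \<in> iso_algebra"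
  by (auto simp: iso_algebra_def k_algebra_def blinfun.bilinear_simps bracket_simps scaleR_add_right)

text \<open>Running \<open>\<gamma>\<close> at speed \<open>s\<close> gives a subgroup with velocity
  \<open>s X\<close>. By uniqueness it is the one that \<open>iso_exp\<close> evaluates at time
  1.\<close>

lemma iso_exp_scaleR:
  assumes X: "X \<in> iso_algebra" and \<gamma>: "one_param_subgroup X \<gamma>"
  shows "iso_exp (s *\<^sub>R X) = \<gamma> s"
proof -
  have "one_param_subgroup (s *\<^sub>R X) (\<lambda>t. \<gamma> (s * t))"
    using \<gamma> has_vector_derivative_compose_affine [of \<gamma> X 0 s 0]
    by (auto simp: one_param_subgroup_def distrib_left)
  then have "(THE \<gamma>. one_param_subgroup (s *\<^sub>R X) \<gamma>) = (\<lambda>t. \<gamma> (s * t))"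
    by (intro the_equality one_param_subgroup_unique [OF iso_algebra_scaleR [OF X]])
  then show ?thesis
    by (simp add: iso_exp_def)
qed

text \<open>Only \<open>\<gamma> 0\<close> and the initial velocity enter, through the product rule
  for the action in its bracket form.\<close>

lemma killing_field_eq:
  assumes "X \<in> iso_algebra"
  shows "killing_field X p = fst X p + snd X + (1/2) *\<^sub>R heis_bracket (snd X) p"
proof -
  obtain \<gamma> where \<gamma>: "one_param_subgroup X \<gamma>"
    using one_param_subgroup_exists [OF assms] .
  then have init: "\<gamma> 0 = (id_blinfun, 0)" and deriv: "(\<gamma> has_vector_derivative X) (at 0)"
    by (simp_all add: one_param_subgroup_def iso_one_def)
  have P: "((\<lambda>t. snd (\<gamma> t)) has_vector_derivative snd X) (at 0)"
    by (rule bounded_linear.has_vector_derivative [OF bounded_linear_snd deriv])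
  have A: "((\<lambda>t. fst (\<gamma> t) p) has_vector_derivative fst X p) (at 0)"
    using has_vector_derivative_blinfun_apply [OF
        bounded_linear.has_vector_derivative [OF bounded_linear_fst deriv]
        has_vector_derivative_const [of p]]
    by (simp add: blinfun.zero_right)
  have "((\<lambda>t. snd (\<gamma> t) + fst (\<gamma> t) p + (1/2) *\<^sub>R heis_bracket (snd (\<gamma> t)) (fst (\<gamma> t) p))
      has_vector_derivative snd X + fst X p + (1/2) *\<^sub>R
        (heis_bracket (snd (\<gamma> 0)) (fst X p) + heis_bracket (snd X) (fst (\<gamma> 0) p))) (at 0)"
    by (intro has_vector_derivative_add P A
        bounded_linear.has_vector_derivative [OF bounded_linear_scaleR_right]
        heis_bracket.has_vector_derivative)
  then have "((\<lambda>s. iso_act (iso_exp (s *\<^sub>R X)) p) has_vector_derivative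
      fst X p + snd X + (1/2) *\<^sub>R heis_bracket (snd X) p) (at 0)"
    by (simp add: iso_exp_scaleR [OF assms \<gamma>] iso_act_def heis_mult_bracket init
        heis_bracket.zero_left add.commute)
  then show ?thesis
    unfolding killing_field_def by (rule vector_derivative_at)
qed

section \<open>The isometry algebra\<close>

text \<open>For fixed \<open>g\<close> the product is affine in the second factor, so the derivative
  is its linear part.\<close>

lemma left_invariant_field_iso:
  "left_invariant_field iso_mult iso_one Y g =
    (fst g o\<^sub>L fst Y, fst g (snd Y) + (1/2) *\<^sub>R heis_bracket (snd g) (fst g (snd Y)))"
proof -
  have "(iso_mult g has_derivative
      (\<lambda>h. (fst g o\<^sub>L fst h, 0 + fst g (snd h) + (1/2) *\<^sub>R heis_bracket (snd g) (fst g (snd h)))))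
      (at iso_one)"
    unfolding iso_mult_def [abs_def] heis_mult_bracket
    by (intro has_derivative_Pair has_derivative_add has_derivative_const has_derivative_scaleR_right
        bounded_linear.has_derivative [OF heis_bracket.bounded_linear_right]
        bounded_linear.has_derivative [OF blinfun.bounded_linear_right]
        bounded_linear.has_derivative [OF
          bounded_bilinear.bounded_linear_right [OF bounded_bilinear_blinfun_compose]]
        has_derivative_fst has_derivative_snd has_derivative_ident)
  from frechet_derivative_at [OF this, symmetric] show ?thesis
    by (simp add: left_invariant_field_def)
qed

text \<open>The left-invariant fields contribute \<open>(1/2) [U, U']\<close> and
  \<open>-(1/2) [U', U]\<close> for the translation parts \<open>U\<close>, \<open>U'\<close>;
  together these give the full bracket.\<close>

lemma iso_bracket_eq:
  "iso_bracket X Y = ((fst X o\<^sub>L fst Y) - (fst Y o\<^sub>L fst X),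
    fst X (snd Y) - fst Y (snd X) + heis_bracket (snd X) (snd Y))"
proof -
  have "(left_invariant_field iso_mult iso_one Y has_derivative
      (\<lambda>h. (fst h o\<^sub>L fst Y, fst h (snd Y) + (1/2) *\<^sub>R
        (heis_bracket (snd iso_one) (fst h (snd Y)) + heis_bracket (snd h) (fst iso_one (snd Y))))))
      (at iso_one)" for Y :: "'a affine_maps"
    unfolding left_invariant_field_iso [abs_def]
    by (intro has_derivative_Pair has_derivative_add has_derivative_scaleR_right
        heis_bracket.FDERIV
        bounded_linear.has_derivative [OF blinfun.bounded_linear_left]
        bounded_linear.has_derivative [OF
          bounded_bilinear.bounded_linear_left [OF bounded_bilinear_blinfun_compose]]
        has_derivative_fst has_derivative_snd has_derivative_ident)
  note der = frechet_derivative_at [OF this, symmetric]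
  have one: "left_invariant_field iso_mult iso_one Y iso_one = Y" for Y :: "'a affine_maps"
    unfolding left_invariant_field_iso by (simp add: iso_one_def heis_bracket.zero_left)
  show ?thesis
    unfolding iso_bracket_def lie_group_bracket_def vector_field_bracket_def der one
    using heis_bracket_skew [of "snd Y" "snd X"] half_add_half [of "heis_bracket (snd X) (snd Y)"]
    by (simp add: iso_one_def heis_bracket.zero_left algebra_simps)
qed

lemma subspace_k_algebra: "subspace k_algebra"
  unfolding k_algebra_def subspace_def
  by (auto simp: blinfun.bilinear_simps bracket_simps heis_bracket.zero_left heis_bracket.zero_right
      scaleR_add_right inner_add_left inner_add_right algebra_simps simp del: split_paired_All)

lemma k_algebra_commutator:
  assumes "D \<in> k_algebra" "D' \<in> k_algebra"
  shows "(D o\<^sub>L D') - (D' o\<^sub>L D) \<in> k_algebra"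
  unfolding k_algebra_def
  by (simp add: blinfun.bilinear_simps bracket_simps k_algebra_bracket assms k_algebra_skew
      inner_diff_left inner_diff_right del: split_paired_All)

lemma subspace_iso_algebra: "subspace iso_algebra"
  unfolding iso_algebra_def by (intro subspace_Times subspace_k_algebra subspace_UNIV)

lemma iso_bracket_closed:
  "X \<in> iso_algebra \<Longrightarrow> Y \<in> iso_algebra \<Longrightarrow> iso_bracket X Y \<in> iso_algebra"
  by (auto simp: iso_algebra_def iso_bracket_eq k_algebra_commutator)

lemma lie_algebra_iso_algebra: "lie_algebra_on iso_algebra iso_bracket"
  unfolding lie_algebra_on_def
proof (intro conjI ballI allI)
  fix X Y Z :: "'a affine_maps" and c :: real
  show "subspace (iso_algebra :: 'a affine_maps set)"
    by (rule subspace_iso_algebra)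
  show "iso_bracket (X + Y) Z = iso_bracket X Z + iso_bracket Y Z"
    "iso_bracket X (Y + Z) = iso_bracket X Y + iso_bracket X Z"
    "iso_bracket (c *\<^sub>R X) Y = c *\<^sub>R iso_bracket X Y" "iso_bracket X (c *\<^sub>R Y) = c *\<^sub>R iso_bracket X Y"
    by (auto intro!: blinfun_eqI
        simp: iso_bracket_eq blinfun.bilinear_simps bracket_simps algebra_simps)
  show "iso_bracket X X = 0"
    by (simp add: iso_bracket_eq zero_prod_def)
  assume "X \<in> iso_algebra" "Y \<in> iso_algebra"
  then show "iso_bracket X Y \<in> iso_algebra"
    by (rule iso_bracket_closed)
  assume "Z \<in> iso_algebra"
  have "fst X \<in> k_algebra" "fst Y \<in> k_algebra" "fst Z \<in> k_algebra"
    using \<open>X \<in> iso_algebra\<close> \<open>Y \<in> iso_algebra\<close> \<open>Z \<in> iso_algebra\<close> by (auto simp: iso_algebra_def)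
  \<comment> \<open>As a rewrite rule this puts the plain translation part first, so that the terms
    from the derivation property cancel.\<close>
  moreover have "heis_bracket (D u) (snd W) = - heis_bracket (snd W) (D u)"
    for D :: "'a heis \<Rightarrow>\<^sub>L 'a heis" and u and W :: "'a affine_maps"
    by (rule heis_bracket_skew)
  ultimately show "iso_bracket X (iso_bracket Y Z) + iso_bracket Y (iso_bracket Z X) +
      iso_bracket Z (iso_bracket X Y) = 0"
    by (auto intro!: blinfun_eqI simp: iso_bracket_eq blinfun.bilinear_simps bracket_simps
        k_algebra_bracket algebra_simps zero_prod_def simp del: split_paired_All)
qed

section \<open>Transport of a Lie algebra along an injective linear map, and the Killing
  fields\<close>

lemma lie_algebra_iso_image:
  assumes "lie_algebra_on L br"
    and add: "\<And>x y. x \<in> L \<Longrightarrow> y \<in> L \<Longrightarrow> \<Phi> (x + y) = \<Phi> x + \<Phi> y"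
    and scale: "\<And>c x. x \<in> L \<Longrightarrow> \<Phi> (c *\<^sub>R x) = c *\<^sub>R \<Phi> x"
    and inj: "inj_on \<Phi> L"
    and bracket: "\<And>x y. x \<in> L \<Longrightarrow> y \<in> L \<Longrightarrow> br' (\<Phi> x) (\<Phi> y) = \<Phi> (br x y)"
  shows "lie_algebra_iso L br (\<Phi> ` L) br' \<Phi>"
proof -
  have L: "subspace L" "\<And>x y. x \<in> L \<Longrightarrow> y \<in> L \<Longrightarrow> br x y \<in> L"
    using assms(1) by (auto simp: lie_algebra_on_def)
  have closed: "0 \<in> L" "\<And>x y. x \<in> L \<Longrightarrow> y \<in> L \<Longrightarrow> x + y \<in> L" "\<And>c x. x \<in> L \<Longrightarrow> c *\<^sub>R x \<in> L"
    using L(1) by (auto simp: subspace_def)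
  have zero: "\<Phi> 0 = 0"
    using scale [of 0 0] closed(1) by simp
  \<comment> \<open>On the image \<open>br'\<close> is given by \<open>br\<close>, so each law is
    the image under \<open>\<Phi>\<close> of the law in \<open>L\<close>.\<close>
  have "lie_algebra_on (\<Phi> ` L) br'"
    unfolding lie_algebra_on_def
  proof (intro conjI ballI allI)
    show "subspace (\<Phi> ` L)"
      unfolding subspace_def
      using closed zero by (auto simp: add [symmetric] scale [symmetric] intro: image_eqI [of _ _ 0])
  qed (use assms(1) L(2) closed zero in \<open>auto simp: lie_algebra_on_def bracket
      add [symmetric] scale [symmetric]\<close>)
  then show ?thesis
    unfolding lie_algebra_iso_def using assms by (auto simp: inj_on_imp_bij_betw)
qed

lemma killing_field_lin:
  assumes "X \<in> iso_algebra" "Y \<in> iso_algebra"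
  shows "killing_field (X + Y) = killing_field X + killing_field Y"
    and "killing_field (c *\<^sub>R X) = c *\<^sub>R killing_field X"
  using assms subspace_add [OF subspace_iso_algebra assms]
    subspace_scale [OF subspace_iso_algebra assms(1), of c]
  by (auto simp: fun_eq_iff killing_field_eq scaleR_fun_def blinfun.bilinear_simps bracket_simps
      algebra_simps simp del: split_paired_All)

text \<open>The value at the unit recovers the translation part; what then remains is the linear
  part.\<close>

lemma inj_on_killing_field: "inj_on killing_field iso_algebra"
proof (rule inj_onI)
  fix X Y :: "'a affine_maps"
  assume X: "X \<in> iso_algebra" and Y: "Y \<in> iso_algebra" and eq: "killing_field X = killing_field Y"
  have *: "fst X p + snd X + (1/2) *\<^sub>R heis_bracket (snd X) p =
    fst Y p + snd Y + (1/2) *\<^sub>R heis_bracket (snd Y) p" for p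
    using fun_cong [OF eq, of p] by (simp add: killing_field_eq X Y)
  have "snd X = snd Y"
    using * [of 0] by (simp add: blinfun.zero_right heis_bracket.zero_right)
  moreover from this have "fst X = fst Y"
    using * by (intro blinfun_eqI) simp
  ultimately show "X = Y"
    by (simp add: prod_eq_iff)
qed

lemma killing_bracket_killing_field:
  "X \<in> iso_algebra \<Longrightarrow> Y \<in> iso_algebra \<Longrightarrow>
    killing_bracket (killing_field X) (killing_field Y) = killing_field (iso_bracket X Y)"
  by (simp add: killing_bracket_def inv_into_f_f inj_on_killing_field)

lemma lie_algebra_iso_killing_field:
  "lie_algebra_iso iso_algebra iso_bracket killing_fields killing_bracket killing_field"
  unfolding killing_fields_def
  by (rule lie_algebra_iso_image) (simp_all add: lie_algebra_iso_algebra killing_field_lin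
      inj_on_killing_field killing_bracket_killing_field)

section \<open>Hamiltonian fields and Poisson brackets\<close>

text \<open>An explicit quadratic polynomial in \<open>p\<close>, in place of
  \<open>inv (dL p)\<close> applied to the field, so that it can be differentiated directly.\<close>

definition trivialized_killing_field :: "'n::finite affine_maps \<Rightarrow> 'n heis \<Rightarrow> 'n heis" where
  "trivialized_killing_field X p =
     fst X p + snd X + heis_bracket (snd X) p - (1/2) *\<^sub>R heis_bracket p (fst X p)"

text \<open>Translating back contributes \<open>-(1/2) [p, U] = (1/2) [U, p]\<close>, which
  completes the half already present in the field.\<close>

lemma inv_dL_killing_field:
  assumes "X \<in> iso_algebra"
  shows "inv (dL p) (killing_field X p) = trivialized_killing_field X p"
  using heis_bracket_skew [of p "snd X"] half_add_half [of "heis_bracket (snd X) p"]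
  by (simp add: inv_dL killing_field_eq assms trivialized_killing_field_def bracket_simps
      algebra_simps)

lemma linear_function_killing_field:
  "X \<in> iso_algebra \<Longrightarrow>
    linear_function (killing_field X) x = trivialized_killing_field X (fst x) \<bullet> snd x"
  by (simp add: linear_function_def heis_metric_def inv_dL_killing_field inv_f_f bij_is_inj [OF bij_dL])

lemma trivialized_killing_field_has_derivative:
  "(trivialized_killing_field X has_derivative (\<lambda>V. fst X V + 0 + heis_bracket (snd X) V -
      (1/2) *\<^sub>R (heis_bracket p (fst X V) + heis_bracket V (fst X p)))) (at p)"
  unfolding trivialized_killing_field_def [abs_def]
  by (intro has_derivative_add has_derivative_diff has_derivative_const has_derivative_scaleR_right
      heis_bracket.FDERIV has_derivative_ident
      bounded_linear.has_derivative [OF heis_bracket.bounded_linear_right]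
      bounded_linear.has_derivative [OF blinfun.bounded_linear_right])

lemma TM_velocity_eq: "TM_velocity x W = (dL (fst x) (fst W), snd W)"
proof -
  have "((\<lambda>t. (heis_mult (fst x) (t *\<^sub>R fst W), snd x + t *\<^sub>R snd W)) has_vector_derivative
      (dL (fst x) (fst W), snd W)) (at 0)"
    by (intro has_vector_derivative_Pair heis_mult_line_has_vector_derivative)
      (auto intro!: derivative_eq_intros)
  then show ?thesis
    unfolding TM_velocity_def by (rule vector_derivative_at)
qed

lemma differential_killing_field:
  assumes X: "X \<in> iso_algebra"
  shows "differential (linear_function (killing_field X)) x W =
    (fst X (fst W) + heis_bracket (trivialized_killing_field X (fst x)) (fst W)) \<bullet> snd x +
    trivialized_killing_field X (fst x) \<bullet> snd W"
proof -
  let ?F = "trivialized_killing_field X" and ?p = "fst x" and ?U = "fst W"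
  let ?F' = "\<lambda>V. fst X V + 0 + heis_bracket (snd X) V -
      (1/2) *\<^sub>R (heis_bracket ?p (fst X V) + heis_bracket V (fst X ?p))"
  have f: "linear_function (killing_field X) = (\<lambda>x. ?F (fst x) \<bullet> snd x)"
    using linear_function_killing_field [OF X] by blast
  have "((\<lambda>x. ?F (fst x)) has_derivative (\<lambda>V. ?F' (fst V))) (at x)"
    using has_derivative_compose [OF has_derivative_fst [OF has_derivative_ident]
        trivialized_killing_field_has_derivative] .
  from has_derivative_inner [OF this has_derivative_snd [OF has_derivative_ident]]
  have "differential (linear_function (killing_field X)) x W =
      ?F ?p \<bullet> snd W + ?F' (dL ?p ?U) \<bullet> snd x"
    unfolding differential_def f TM_velocity_eq by (simp add: frechet_derivative_at [symmetric])
  \<comment> \<open>With \<open>D = fst X\<close>, the derivation property applied to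
    \<open>D [p, U]\<close> cancels \<open>[p, D U]\<close> and supplies the second half of
    \<open>[D p, U]\<close>. Modulo the centre, \<open>?F ?p\<close> is
    \<open>D p + snd X\<close>.\<close>
  also have "?F' (dL ?p ?U) = fst X ?U + heis_bracket (?F ?p) ?U"
  proof -
    have "fst X \<in> k_algebra"
      using X by (auto simp: iso_algebra_def)
    then show ?thesis
      using heis_bracket_skew [of "fst X ?p" ?U] half_add_half [of "heis_bracket (fst X ?p) ?U"]
      by (simp add: dL_bracket trivialized_killing_field_def bracket_simps blinfun.bilinear_simps
          k_algebra_bracket algebra_simps)
  qed
  finally show ?thesis
    by simp
qed

text \<open>Vertical test vectors detect the first component. Once these agree, so do the bracket
  terms, and horizontal test vectors detect the second.\<close>

lemma \<Omega>_nondegenerate: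
  assumes "\<And>W'. \<Omega> x W W' = \<Omega> x V W'"
  shows "W = V"
proof -
  have "fst W \<bullet> u = fst V \<bullet> u" for u
    using assms [of "(0, u)"] by (simp add: \<Omega>_def heis_bracket.zero_right)
  then have "fst W = fst V"
    using vector_eq_rdot by blast
  moreover have "snd W \<bullet> u = snd V \<bullet> u" for u
    using assms [of "(u, 0)"] \<open>fst W = fst V\<close> by (simp add: \<Omega>_def)
  then have "snd W = snd V"
    using vector_eq_rdot by blast
  ultimately show ?thesis
    by (simp add: prod_eq_iff)
qed

text \<open>Skewness moves \<open>fst X\<close> from the horizontal direction to the fibre variable
  \<open>snd x\<close>, with the sign that the second term of \<open>\<Omega>\<close>
  carries.\<close>

lemma hamiltonian_field_killing_field:
  assumes X: "X \<in> iso_algebra"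
  shows "hamiltonian_field (linear_function (killing_field X)) x =
    (trivialized_killing_field X (fst x), fst X (snd x))"
  unfolding hamiltonian_field_def
proof (rule the_equality)
  have "fst X \<in> k_algebra"
    using X by (auto simp: iso_algebra_def)
  then have "fst X U \<bullet> snd x = - (fst X (snd x) \<bullet> U)" for U
    using k_algebra_skew inner_commute by metis
  then show *: "\<forall>W'. differential (linear_function (killing_field X)) x W' =
      \<Omega> x (trivialized_killing_field X (fst x), fst X (snd x)) W'"
    by (simp add: differential_killing_field [OF X] \<Omega>_def inner_add_left
        inner_commute [of "snd x" "heis_bracket _ _"] del: split_paired_All)
  show "W = (trivialized_killing_field X (fst x), fst X (snd x))"
    if "\<forall>W'. differential (linear_function (killing_field X)) x W' = \<Omega> x W W'" for W
    using that * by (intro \<Omega>_nondegenerate [of x]) metis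
qed

text \<open>Paired with the fibre variable, the right-hand side is the Poisson bracket of the two
  functions. The mixed brackets cancel by skew symmetry, and the two halves of
  \<open>[D p, D' p]\<close> from the derivation property cancel the one in
  \<open>[F p, G p]\<close>, where \<open>D\<close>, \<open>D'\<close> are the linear parts.\<close>

lemma trivialized_killing_field_iso_bracket:
  assumes "X \<in> iso_algebra" "Y \<in> iso_algebra"
  defines "F \<equiv> trivialized_killing_field X" and "G \<equiv> trivialized_killing_field Y"
  shows "trivialized_killing_field (iso_bracket X Y) p =
    fst X (G p) - fst Y (F p) + heis_bracket (F p) (G p)"
proof -
  have "fst X \<in> k_algebra" "fst Y \<in> k_algebra"
    using assms(1,2) by (auto simp: iso_algebra_def)
  then show ?thesis
    using heis_bracket_skew [of "snd Y" "fst X p"] heis_bracket_skew [of "fst Y p" "fst X p"]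
      half_add_half [of "heis_bracket (fst X p) (fst Y p)"]
    by (simp add: F_def G_def trivialized_killing_field_def iso_bracket_eq bracket_simps
        blinfun.bilinear_simps k_algebra_bracket algebra_simps)
qed

lemma poisson_bracket_killing_field:
  assumes X: "X \<in> iso_algebra" and Y: "Y \<in> iso_algebra"
  shows "poisson_bracket (linear_function (killing_field X)) (linear_function (killing_field Y)) =
    linear_function (killing_field (iso_bracket X Y))"
proof
  fix x :: "'a heis_TM"
  have "fst X \<in> k_algebra" "fst Y \<in> k_algebra"
    using assms by (auto simp: iso_algebra_def)
  \<comment> \<open>These rules move both linear parts off the fibre variable, making all three
    terms of \<open>\<Omega>\<close> inner products with \<open>snd x\<close>.\<close>
  then have "u \<bullet> fst Y (snd x) = - (fst Y u \<bullet> snd x)" "fst X (snd x) \<bullet> u = - (fst X u \<bullet> snd x)" for u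
    using k_algebra_skew inner_commute minus_minus by metis+
  then show "poisson_bracket (linear_function (killing_field X)) (linear_function (killing_field Y)) x =
      linear_function (killing_field (iso_bracket X Y)) x"
    using assms
    by (simp add: poisson_bracket_def hamiltonian_field_killing_field \<Omega>_def
        linear_function_killing_field iso_bracket_closed trivialized_killing_field_iso_bracket
        inner_add_left inner_diff_left inner_commute [of "snd x" "heis_bracket _ _"])
qed

section \<open>From Killing fields to functions on the tangent bundle\<close>

lemma linear_function_lin:
  "linear_function (\<xi> + \<eta>) = linear_function \<xi> + linear_function \<eta>"
  "linear_function (c *\<^sub>R \<xi>) = c *\<^sub>R linear_function \<xi>"
  by (simp_all add: fun_eq_iff linear_function_def heis_metric_def inv_dL scaleR_fun_def bracket_simps
      inner_add_left inner_diff_left algebra_simps del: split_paired_All)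

text \<open>The inner products with all vectors \<open>dL p Y\<close> determine a tangent vector at
  \<open>p\<close>, since the metric is nondegenerate.\<close>

lemma inj_linear_function: "inj linear_function"
proof (rule injI)
  fix \<xi> \<eta> :: "'a heis \<Rightarrow> 'a heis"
  assume eq: "linear_function \<xi> = linear_function \<eta>"
  show "\<xi> = \<eta>"
  proof
    fix p
    have "inv (dL p) (\<xi> p) \<bullet> Y = inv (dL p) (\<eta> p) \<bullet> Y" for Y
      using fun_cong [OF eq, of "(p, Y)"]
      by (simp add: linear_function_def heis_metric_def inv_f_f bij_is_inj [OF bij_dL])
    then have "inv (dL p) (\<xi> p) = inv (dL p) (\<eta> p)"
      using vector_eq_rdot by blast
    then show "\<xi> p = \<eta> p"
      using bij_is_inj [OF bij_imp_bij_inv [OF bij_dL [of p]]] by (simp add: inj_eq)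
  qed
qed

lemma lie_algebra_iso_linear_function:
  "lie_algebra_iso killing_fields killing_bracket (linear_function ` killing_fields)
     poisson_bracket linear_function"
proof (rule lie_algebra_iso_image)
  show "lie_algebra_on killing_fields killing_bracket"
    using lie_algebra_iso_killing_field unfolding lie_algebra_iso_def by blast
  show "inj_on linear_function killing_fields"
    using inj_linear_function by (rule inj_on_subset) simp
  show "poisson_bracket (linear_function \<xi>) (linear_function \<eta>) =
      linear_function (killing_bracket \<xi> \<eta>)"
    if "\<xi> \<in> killing_fields" "\<eta> \<in> killing_fields" for \<xi> \<eta> :: "'a heis \<Rightarrow> 'a heis"
    using that by (auto simp: killing_fields_def poisson_bracket_killing_field
        killing_bracket_killing_field)
qed (simp_all add: linear_function_lin)

section \<open>Smoothness\<close>

text \<open>Lets explicit derivatives stand in for \<open>frechet_derivative\<close>.\<close>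

lemma Ck_SucI:
  assumes "\<And>x. (f has_derivative f' x) (at x)" and "\<And>v. Ck k (\<lambda>x. f' x v)"
  shows "Ck (Suc k) f"
proof -
  have "frechet_derivative f (at x) = f' x" for x
    using frechet_derivative_at [OF assms(1)] by (rule sym)
  moreover have "f differentiable at x" for x
    using assms(1) by (rule differentiableI)
  ultimately show ?thesis
    using assms(2) by simp
qed

lemma Ck_SucD:
  assumes "Ck (Suc k) f"
  shows "(f has_derivative frechet_derivative f (at x)) (at x)"
    and "Ck k (\<lambda>x. frechet_derivative f (at x) v)"
  using assms by (simp_all add: frechet_derivative_works [symmetric])

text \<open>Differentiability gives continuity in the base case. The product rule below relies on
  this for the factor that is not differentiated.\<close>

lemma Ck_Suc_imp_Ck: "Ck (Suc k) f \<Longrightarrow> Ck k f"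
proof (induction k arbitrary: f)
  case 0
  then show ?case
    by (auto intro!: continuous_at_imp_continuous_on differentiable_imp_continuous_within)
next
  case (Suc k)
  show ?case
    by (rule Ck_SucI [OF Ck_SucD(1) [OF Suc.prems]]) (rule Suc.IH [OF Ck_SucD(2) [OF Suc.prems]])
qed

lemma Ck_const: "Ck k (\<lambda>x. c)"
proof (induction k arbitrary: c)
  case (Suc k)
  show ?case
    by (rule Ck_SucI [OF has_derivative_const Suc])
qed simp

lemma Ck_bounded_linear:
  assumes "bounded_linear f"
  shows "Ck k f"
proof -
  \<comment> \<open>The derivative is the same at every point; proving one order more treats
    \<open>k = 0\<close> along with the rest.\<close>
  have "Ck (Suc k) f"
    by (rule Ck_SucI [OF bounded_linear_imp_has_derivative [OF assms] Ck_const])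
  then show ?thesis
    by (rule Ck_Suc_imp_Ck)
qed

lemma Ck_add: "Ck k f \<Longrightarrow> Ck k g \<Longrightarrow> Ck k (\<lambda>x. f x + g x)"
proof (induction k arbitrary: f g)
  case 0
  then show ?case
    by (simp add: continuous_on_add)
next
  case (Suc k)
  show ?case
    by (rule Ck_SucI [OF has_derivative_add [OF Ck_SucD(1) [OF Suc.prems(1)] Ck_SucD(1) [OF Suc.prems(2)]]])
      (intro Suc.IH Ck_SucD(2) [OF Suc.prems(1)] Ck_SucD(2) [OF Suc.prems(2)])
qed

lemma Ck_bounded_bilinear:
  assumes "bounded_bilinear B"
  shows "Ck k f \<Longrightarrow> Ck k g \<Longrightarrow> Ck k (\<lambda>x. B (f x) (g x))"
proof (induction k arbitrary: f g)
  case 0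
  then show ?case
    by (simp add: bounded_bilinear.continuous_on [OF assms])
next
  case (Suc k)
  note fg = Suc.prems [THEN Ck_Suc_imp_Ck]
  show ?case
    by (rule Ck_SucI [OF bounded_bilinear.FDERIV [OF assms
          Ck_SucD(1) [OF Suc.prems(1)] Ck_SucD(1) [OF Suc.prems(2)]]])
      (intro Ck_add Suc.IH fg Ck_SucD(2) [OF Suc.prems(1)] Ck_SucD(2) [OF Suc.prems(2)])
qed

lemma smooth_linear_function_killing_field:
  assumes "X \<in> iso_algebra"
  shows "smooth (linear_function (killing_field X))"
  unfolding smooth_def
proof
  fix k
  have p: "Ck k (\<lambda>x. fst X (fst (x :: 'a heis_TM)))"
    by (intro Ck_bounded_linear bounded_linear_compose [OF blinfun.bounded_linear_right bounded_linear_fst])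
  \<comment> \<open>The difference is written as a sum with factor \<open>- 1/2\<close>, so that the
    rules for sums and bilinear maps cover the whole polynomial.\<close>
  have "Ck k (\<lambda>x :: 'a heis_TM. (fst X (fst x) + snd X + heis_bracket (snd X) (fst x) +
      (- 1/2) *\<^sub>R heis_bracket (fst x) (fst X (fst x))) \<bullet> snd x)"
    by (intro Ck_bounded_bilinear [OF bounded_bilinear_inner] Ck_add Ck_const p
        Ck_bounded_bilinear [OF bounded_bilinear_heis_bracket]
        Ck_bounded_bilinear [OF bounded_bilinear_scaleR]
        Ck_bounded_linear bounded_linear_fst bounded_linear_snd)
  moreover have "linear_function (killing_field X) = (\<lambda>x. (fst X (fst x) + snd X +
      heis_bracket (snd X) (fst x) + (- 1/2) *\<^sub>R heis_bracket (fst x) (fst X (fst x))) \<bullet> snd x)"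
    by (simp add: fun_eq_iff linear_function_killing_field [OF assms] trivialized_killing_field_def
        del: split_paired_All)
  ultimately show "Ck k (linear_function (killing_field X))"
    by simp
qed

theorem theorem4p8:
  shows "lie_algebra_iso (iso_algebra :: 'n::finite affine_maps set) iso_bracket
           killing_fields killing_bracket killing_field
       \<and> (\<forall>\<xi> \<in> (killing_fields :: ('n heis \<Rightarrow> 'n heis) set). smooth (linear_function \<xi>))
       \<and> lie_algebra_iso (killing_fields :: ('n heis \<Rightarrow> 'n heis) set) killing_bracket
           (linear_function ` killing_fields) poisson_bracket linear_function"
  using lie_algebra_iso_killing_field lie_algebra_iso_linear_function
    smooth_linear_function_killing_field
  by (auto simp: killing_fields_def)

end
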